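(* Let $X$ be a compact Hausdorff space, let $T:X\to X$ be a surjective continuous map, and let $G$ be ${\mathbb Z}_{\geq 0}$ (or ${\mathbb Z}$, in which case $T$ is assumed to be a homeomorphism), acting on $X$ by $n\cdot x=T^n x$. Let $k\geq 2$ and let $(x_1,\dots,x_k)\in X^k\setminus\Delta_k(X)$. Then $(x_1,\dots,x_k)$ is an entropy tuple if and only if it is an IE-tuple.
   Context: $\Delta_k(X)=\{(x,\dots,x)\in X^k: x\in X\}$. For an open cover ${\mathcal U}$ of $X$, $N({\mathcal U})$ is the minimal cardinality of a subcover, and the topological entropy of ${\mathcal U}$ is ${\rm h}_{\rm top}(T,{\mathcal U})=\lim_{n\to\infty}\frac1n\ln N({\mathcal U}\vee T^{-1}{\mathcal U}\vee\cdots\vee T^{-n+1}{\mathcal U})$. A tuple $(x_1,\dots,x_k)\in X^k\setminus\Delta_k(X)$ is an entropy tuple if whenever $U_1,\dots,U_l$ are closed pairwise disjoint neighbourhoods of the distinct points in the list $x_1,\dots,x_k$, the open cover $\{U_1^{\rm c},\dots,U_l^{\rm c}\}$ has positive topological entropy. For a tuple $(A_1,\dots,A_k)$ of subsets of $X$, a set $J\subseteq G$ is an independence set for it if for every nonempty finite $I\subseteq J$ and every $\sigma:I\to\{1,\dots,k\}$ one has $\bigcap_{s\in I}T^{-s}A_{\sigma(s)}\neq\emptyset$. A set $I\subseteq{\mathbb Z}$ has positive density if $\lim_{n\to\infty}|I\cap\{-n,\dots,n\}|/(2n+1)$ exists and is nonzero; a set $I\subseteq{\mathbb Z}_{\ge0}$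 has positive density if $\lim_{n\to\infty}|I\cap\{0,\dots,n\}|/(n+1)$ exists and is nonzero. A tuple $(x_1,\dots,x_k)\in X^k$ is an IE-tuple if for every product neighbourhood $U_1\times\cdots\times U_k$ of it, the tuple $(U_1,\dots,U_k)$ has an independence set of positive density. *)

theory Defs
  imports "HOL-Analysis.Analysis"
begin

text \<open>Tuples (x_1,...,x_k) in X^k are represented as functions x :: nat => 'a,
  using the indices 0..k-1. The space X is the whole type 'a.\<close>

definition off_diagonal :: "nat \<Rightarrow> (nat \<Rightarrow> 'a) \<Rightarrow> bool" where
  "off_diagonal k x \<longleftrightarrow> (\<exists>i<k. \<exists>j<k. x i \<noteq> x j)"

definition join_cover :: "('a \<Rightarrow> 'a) \<Rightarrow> 'a set set \<Rightarrow> nat \<Rightarrow> 'a set set" where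
  "join_cover T U n = {(\<Inter>i\<in>{..<n}. (T ^^ i) -` (A i)) | A. \<forall>i<n. A i \<in> U}"

definition cover_number :: "'a set set \<Rightarrow> nat" where
  "cover_number U = (LEAST m. \<exists>V\<subseteq>U. finite V \<and> card V = m \<and> \<Union>V = UNIV)"

definition cover_entropy :: "('a \<Rightarrow> 'a) \<Rightarrow> 'a set set \<Rightarrow> real" where
  "cover_entropy T U = lim (\<lambda>n. ln (real (cover_number (join_cover T U n))) / real n)"

text \<open>Entropy tuple: for closed pairwise disjoint neighbourhoods of the distinct points
  (one neighbourhood per distinct point: equal points get the same set), the cover by
  their complements has positive entropy.\<close>
definition entropy_tuple :: "('a::topological_space \<Rightarrow> 'a) \<Rightarrow> nat \<Rightarrow> (nat \<Rightarrow> 'a) \<Rightarrow> bool" where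
  "entropy_tuple T k x \<longleftrightarrow> off_diagonal k x \<and>
     (\<forall>V :: nat \<Rightarrow> 'a set.
        (\<forall>i<k. closed (V i) \<and> x i \<in> interior (V i)) \<and>
        (\<forall>i<k. \<forall>j<k. (x i = x j \<longrightarrow> V i = V j) \<and> (x i \<noteq> x j \<longrightarrow> V i \<inter> V j = {}))
        \<longrightarrow> cover_entropy T {- V i | i. i < k} > 0)"

definition indep_set_nat :: "('a \<Rightarrow> 'a) \<Rightarrow> nat \<Rightarrow> (nat \<Rightarrow> 'a set) \<Rightarrow> nat set \<Rightarrow> bool" where
  "indep_set_nat T k A J \<longleftrightarrow>
     (\<forall>I (\<sigma> :: nat \<Rightarrow> nat). I \<subseteq> J \<and> finite I \<and> I \<noteq> {} \<and> (\<forall>s\<in>I. \<sigma> s < k)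
        \<longrightarrow> (\<Inter>s\<in>I. (T ^^ s) -` A (\<sigma> s)) \<noteq> {})"

definition pos_density_nat :: "nat set \<Rightarrow> bool" where
  "pos_density_nat I \<longleftrightarrow>
     (\<exists>d::real. d \<noteq> 0 \<and> (\<lambda>n. real (card (I \<inter> {0..n})) / real (n + 1)) \<longlonglongrightarrow> d)"

definition IE_tuple_nat :: "('a::topological_space \<Rightarrow> 'a) \<Rightarrow> nat \<Rightarrow> (nat \<Rightarrow> 'a) \<Rightarrow> bool" where
  "IE_tuple_nat T k x \<longleftrightarrow>
     (\<forall>U :: nat \<Rightarrow> 'a set. (\<forall>i<k. x i \<in> interior (U i)) \<longrightarrow>
        (\<exists>J. indep_set_nat T k U J \<and> pos_density_nat J))"

definition zact :: "('a \<Rightarrow> 'a) \<Rightarrow> int \<Rightarrow> 'a \<Rightarrow> 'a" where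
  "zact T s = (if s \<ge> 0 then T ^^ nat s else (inv T) ^^ nat (- s))"

definition indep_set_int :: "('a \<Rightarrow> 'a) \<Rightarrow> nat \<Rightarrow> (nat \<Rightarrow> 'a set) \<Rightarrow> int set \<Rightarrow> bool" where
  "indep_set_int T k A J \<longleftrightarrow>
     (\<forall>I (\<sigma> :: int \<Rightarrow> nat). I \<subseteq> J \<and> finite I \<and> I \<noteq> {} \<and> (\<forall>s\<in>I. \<sigma> s < k)
        \<longrightarrow> (\<Inter>s\<in>I. (zact T s) -` A (\<sigma> s)) \<noteq> {})"

definition pos_density_int :: "int set \<Rightarrow> bool" where
  "pos_density_int I \<longleftrightarrow>
     (\<exists>d::real. d \<noteq> 0 \<and>
        (\<lambda>n::nat. real (card (I \<inter> {- int n..int n})) / real (2 * n + 1)) \<longlonglongrightarrow> d)"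

definition IE_tuple_int :: "('a::topological_space \<Rightarrow> 'a) \<Rightarrow> nat \<Rightarrow> (nat \<Rightarrow> 'a) \<Rightarrow> bool" where
  "IE_tuple_int T k x \<longleftrightarrow>
     (\<forall>U :: nat \<Rightarrow> 'a set. (\<forall>i<k. x i \<in> interior (U i)) \<longrightarrow>
        (\<exists>J. indep_set_int T k U J \<and> pos_density_int J))"

end

theory Submission
  imports Defs
begin

text \<open>
  If the cover by the complements of disjoint sets \<open>A\<^sub>1, \<dots>, A\<^sub>k\<close> has positive entropy, then the
  least number of itineraries that cover the space grows exponentially. A Sauer-Shelah type induction
  on the time window \<open>{0..<n}\<close> bounds that number by \<open>r\<^sup>n\<close> times a fixed power of the number of
  independence sets in the window, with \<open>r > 1\<close> as close to 1 as desired. So there are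
  exponentially many independence sets, and one of them has size at least \<open>c n\<close>. Let \<open>d > 0\<close> be the
  limit of the maximal densities of independence sets in windows of length \<open>n\<close>, which exists
  by subadditivity. In an almost optimal set some starting point sees density almost \<open>d\<close> on every
  later window up to a given length; translating to that point and passing to a cluster
  point gives an independence set whose density exists and equals \<open>d\<close>.

  Conversely, on an independence set of size \<open>m\<close> all \<open>k\<^sup>m\<close> patterns occur, whereas a member of the
  joined cover meets at most \<open>(k - 1)\<^sup>m\<close> of them. A subset of the nonnegative integers with density
  \<open>d\<close> has density \<open>d / 2\<close> in the integers, and a homeomorphism translates windows around 0 to
  windows of nonnegative integers, so the invertible case reduces to the one-sided one.
\<close>

section \<open>Subadditive sequences\<close>

text \<open>Fekete: division with remainder by an \<open>m\<close> with almost minimal quotient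
  bounds all later quotients. The limit is the infimum, so the second conclusion has no error term;
  it supplies the sharp lower bound in the density argument.\<close>

lemma fekete_subadditive:
  fixes a :: "nat \<Rightarrow> real"
  assumes nonneg: "\<And>n. 0 \<le> a n" and subadd: "\<And>m n. a (m + n) \<le> a m + a n"
  obtains L where "(\<lambda>n. a n / real n) \<longlonglongrightarrow> L" "\<And>n. L * real n \<le> a n"
proof -
  define L where "L = (INF n\<in>{1..}. a n / real n)"
  have bdd: "bdd_below ((\<lambda>n. a n / real n) ` {1..})"
    by (rule bdd_belowI[of _ 0]) (auto simp: nonneg)
  have lower: "L \<le> a n / real n" if "n \<ge> 1" for n
    unfolding L_def by (rule cINF_lower[OF bdd]) (use that in auto)
  have multiple: "a (q * m + r) \<le> real q * a m + a r" for q m r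
  proof (induction q)
    case (Suc q)
    have "a (Suc q * m + r) \<le> a m + a (q * m + r)"
      using subadd[of m "q * m + r"] by (simp add: add.assoc)
    with Suc show ?case by (simp add: algebra_simps)
  qed simp
  have upper: "\<forall>\<^sub>F n in sequentially. a n / real n < L + e" if "e > 0" for e
  proof -
    have "\<exists>m\<in>{1..}. a m / real m < L + e / 2"
      using cINF_less_iff[OF _ bdd, of "L + e / 2"] that by (auto simp: L_def)
    then obtain m where m: "m \<ge> 1" "a m / real m < L + e / 2" by auto
    \<comment> \<open>One constant that dominates \<open>a\<close> on every remainder modulo
      \<open>m\<close>; its share vanishes after division by \<open>n\<close>.\<close>
    define B where "B = (\<Sum>r<m. a r)"
    have "(\<lambda>n. B / real n) \<longlonglongrightarrow> 0"
      by (rule lim_const_over_n)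
    then have "\<forall>\<^sub>F n in sequentially. B / real n < e / 2"
      by (rule order_tendstoD) (use that in auto)
    moreover have "\<forall>\<^sub>F n in sequentially. n \<ge> (1::nat)"
      by (rule eventually_ge_at_top)
    ultimately show ?thesis
    proof eventually_elim
      case (elim n)
      have "a (n mod m) \<le> B"
        unfolding B_def by (rule member_le_sum) (use m nonneg in auto)
      moreover have "a n \<le> real (n div m) * a m + a (n mod m)"
        using multiple[of "n div m" m "n mod m"] by simp
      moreover have "real (n div m) * a m \<le> real n / real m * a m"
        by (intro mult_right_mono nonneg) (rule of_nat_div_le_of_nat)
      ultimately have "a n \<le> real n / real m * a m + B" by linarith
      then have "a n / real n \<le> (real n / real m * a m + B) / real n"
        by (intro divide_right_mono) auto
      also have "\<dots> = a m / real m + B / real n"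
        using elim m by (simp add: field_simps)
      finally show ?case using elim m by linarith
    qed
  qed
  have "(\<lambda>n. a n / real n) \<longlonglongrightarrow> L"
  proof (rule order_tendstoI)
    fix l assume "l < L"
    show "\<forall>\<^sub>F n in sequentially. l < a n / real n"
      using eventually_ge_at_top[of 1]
      by eventually_elim (use lower \<open>l < L\<close> in \<open>force intro: less_le_trans\<close>)
  next
    fix u assume "L < u"
    then show "\<forall>\<^sub>F n in sequentially. a n / real n < u"
      using upper[of "u - L"] by simp
  qed
  moreover have "L * real n \<le> a n" for n
  proof (cases "n = 0")
    case False
    then show ?thesis using lower[of n] by (simp add: field_simps)
  qed (simp add: nonneg)
  ultimately show ?thesis by (rule that)
qed

section \<open>Covers and shattered sets\<close>

text \<open>
  If the union is not larger than the smallest set by the factor \<open>1 + 1 / (k + 1)\<close>, then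
  all the sets nearly agree, and the intersection makes up for it.
\<close>

lemma card_Union_Inter_ge:
  fixes D :: "nat \<Rightarrow> 'b set"
  assumes fin: "\<And>i. i < k \<Longrightarrow> finite (D i)" and "k > 0"
  shows "\<exists>i<k. real (k + 2) * real (card (D i))
           \<le> real (k + 1) * real (card (\<Union>i<k. D i) + card (\<Inter>i<k. D i))"
proof -
  obtain i where i: "i < k" and min: "\<And>j. j < k \<Longrightarrow> card (D i) \<le> card (D j)"
    using arg_min_if_finite[of "{..<k}" "\<lambda>j. card (D j)"] \<open>k > 0\<close>
    by (metis (no_types, lifting) empty_iff finite_lessThan lessThan_iff linorder_not_le)
  define U where "U = (\<Union>i<k. D i)"
  define I where "I = (\<Inter>i<k. D i)"
  have finU: "finite U" unfolding U_def using fin by auto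
  have sub: "D j \<subseteq> U" if "j < k" for j using that by (auto simp: U_def)
  have "I \<subseteq> U" using sub[OF i] i by (auto simp: I_def)
  \<comment> \<open>A point outside the intersection is missed by some \<open>D j\<close>, and each
    \<open>D j\<close> misses at most as many points of \<open>U\<close> as the smallest set
    does.\<close>
  have "U - I \<subseteq> (\<Union>j<k. U - D j)" by (auto simp: I_def)
  then have "card (U - I) \<le> card (\<Union>j<k. U - D j)"
    using finU by (intro card_mono) auto
  also have "\<dots> \<le> (\<Sum>j<k. card (U - D j))" by (rule card_UN_le) simp
  also have "\<dots> \<le> (\<Sum>j<k. card U - card (D i))"
    by (intro sum_mono) (simp add: card_Diff_subset sub fin diff_le_mono2 min)
  finally have "card (U - I) \<le> k * (card U - card (D i))" by simp
  moreover have "card (D i) \<le> card U" using sub[OF i] finU by (rule card_mono[rotated])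
  moreover have "card (U - I) = card U - card I" "card I \<le> card U"
    using \<open>I \<subseteq> U\<close> finU by (auto simp: card_Diff_subset finite_subset card_mono)
  ultimately have *: "real (card U) - real (card I) \<le> real k * (real (card U) - real (card (D i)))"
    "real (card (D i)) \<le> real (card U)"
    by (metis of_nat_diff of_nat_le_iff of_nat_mult)+
  define c u v where "c = real (card (D i))" and "u = real (card U)" and "v = real (card I)"
  have "real (k + 2) * c \<le> real (k + 1) * (u + v)"
  proof (cases "real (k + 2) * c \<le> real (k + 1) * u")
    case True
    then show ?thesis by (simp add: distrib_left v_def add_increasing2)
  next
    \<comment> \<open>Here \<open>u\<close> is close to \<open>c\<close>, so the intersection is
      large: \<open>u + v\<close> is at least \<open>2 * c - k * (u - c)\<close>, and
      \<open>k * (u - c)\<close> is at most \<open>k / (k + 1) * c\<close>.\<close>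
    case False
    then have 1: "real (k + 1) * (u - c) \<le> c" by (simp add: algebra_simps)
    have "v \<ge> u - real k * (u - c)" "u \<ge> c" using * by (simp_all add: c_def u_def v_def)
    then have "real (k + 1) * (u + v) \<ge> real (k + 1) * (2 * c - real k * (u - c))"
      by (intro mult_left_mono) auto
    moreover have "real k * (real (k + 1) * (u - c)) \<le> real k * c"
      using 1 by (intro mult_left_mono) auto
    ultimately show ?thesis by (simp add: algebra_simps)
  qed
  then show ?thesis using i by (auto simp: c_def u_def v_def U_def I_def)
qed

text \<open>Sauer-Shelah shattering with \<open>k\<close> labels inside the part \<open>S\<close> of
  the space; the empty set is shattered exactly when \<open>S\<close> is nonempty. Later
  \<open>z\<close> is a time and \<open>A z i\<close> holds the points that are in the
  \<open>i\<close>-th set at that time.\<close>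

definition shattered :: "('z \<Rightarrow> nat \<Rightarrow> 'b set) \<Rightarrow> nat \<Rightarrow> 'z set \<Rightarrow> 'b set \<Rightarrow> 'z set set" where
  "shattered A k Z S =
     {W. W \<subseteq> Z \<and> (\<forall>\<sigma>. (\<forall>z\<in>W. \<sigma> z < k) \<longrightarrow> S \<inter> (\<Inter>z\<in>W. A z (\<sigma> z)) \<noteq> {})}"

lemma finite_shattered: "finite Z \<Longrightarrow> finite (shattered A k Z S)"
  by (rule finite_subset[of _ "Pow Z"]) (auto simp: shattered_def)

lemma shattered_mono: "Z \<subseteq> Z' \<Longrightarrow> S \<subseteq> S' \<Longrightarrow> shattered A k Z S \<subseteq> shattered A k Z' S'"
  unfolding shattered_def by blast

text \<open>The label \<open>\<sigma> z\<close> tells in which of the \<open>k\<close> parts of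
  \<open>S\<close> to look for the rest of the pattern.\<close>

lemma insert_shattered:
  assumes "\<And>i. i < k \<Longrightarrow> W \<in> shattered A k Z (S \<inter> A z i)" "z \<notin> Z" "k > 0"
  shows "insert z W \<in> shattered A k (insert z Z) S"
proof -
  have "W \<subseteq> Z" using assms(1)[OF \<open>k > 0\<close>] by (auto simp: shattered_def)
  moreover have "S \<inter> (\<Inter>w\<in>insert z W. A w (\<sigma> w)) \<noteq> {}" if "\<forall>w\<in>insert z W. \<sigma> w < k" for \<sigma>
  proof -
    have "(S \<inter> A z (\<sigma> z)) \<inter> (\<Inter>w\<in>W. A w (\<sigma> w)) \<noteq> {}"
      using assms(1)[of "\<sigma> z"] that unfolding shattered_def by blast
    then show ?thesis by auto
  qed
  ultimately show ?thesis unfolding shattered_def by blast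
qed

text \<open>Shattering in one part of \<open>S\<close> gives shattering in \<open>S\<close>;
  shattering in all parts survives adding \<open>z\<close>. The sets of the first kind avoid
  \<open>z\<close> and the enlarged ones contain it, so nothing is counted twice.\<close>

lemma card_shattered_insert:
  assumes "finite Z" "z \<notin> Z" "k > 0"
  shows "card (\<Union>i<k. shattered A k Z (S \<inter> A z i)) + card (\<Inter>i<k. shattered A k Z (S \<inter> A z i))
           \<le> card (shattered A k (insert z Z) S)"
proof -
  let ?U = "\<Union>i<k. shattered A k Z (S \<inter> A z i)" and ?I = "\<Inter>i<k. shattered A k Z (S \<inter> A z i)"
  have subU: "?U \<subseteq> Pow Z" by (auto simp: shattered_def)
  have subI: "?I \<subseteq> Pow Z" using \<open>k > 0\<close> by (auto simp: shattered_def)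
  have "inj_on (insert z) ?I"
  proof (rule inj_onI)
    fix V W assume "V \<in> ?I" "W \<in> ?I" and eq: "insert z V = insert z W"
    then have "z \<notin> V" "z \<notin> W" using subI \<open>z \<notin> Z\<close> by blast+
    then show "V = W" using eq by (simp add: insert_ident)
  qed
  then have "card ?U + card ?I = card ?U + card (insert z ` ?I)" by (simp add: card_image)
  also have "\<dots> = card (?U \<union> insert z ` ?I)"
  proof (rule card_Un_disjoint[symmetric])
    show "finite ?U" "finite (insert z ` ?I)"
      using subU subI \<open>finite Z\<close> by (auto intro: finite_subset)
    show "?U \<inter> insert z ` ?I = {}" using subU \<open>z \<notin> Z\<close> by blast
  qed
  also have "\<dots> \<le> card (shattered A k (insert z Z) S)"
  proof (rule card_mono)
    have "?U \<subseteq> shattered A k (insert z Z) S"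
      by (intro UN_least shattered_mono) auto
    moreover have "insert z ` ?I \<subseteq> shattered A k (insert z Z) S"
      by (auto intro!: insert_shattered assms)
    ultimately show "?U \<union> insert z ` ?I \<subseteq> shattered A k (insert z Z) S" by simp
  qed (simp add: finite_shattered assms)
  finally show ?thesis .
qed

text \<open>The value \<open>a z\<close> names a set avoided at \<open>z\<close>, so
  \<open>a\<close> is an itinerary through complements. The induction splits \<open>S\<close> at a
  new coordinate along a well-chosen \<open>A z i\<close>: inside it the number of shattered sets
  drops by the factor \<open>q\<close>, so that half costs only \<open>q ^ p\<close>, and
  \<open>1 + q ^ p\<close> is at most \<open>r\<close>.\<close>

lemma cover_card_le_shattered:
  fixes A :: "'z \<Rightarrow> nat \<Rightarrow> 'b set" and r :: real
  assumes "k \<ge> 2" and r: "((real k + 1) / (real k + 2)) ^ p \<le> r - 1"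
    and "finite Z"
    and disj: "\<And>z i j. z \<in> Z \<Longrightarrow> i < k \<Longrightarrow> j < k \<Longrightarrow> i \<noteq> j \<Longrightarrow> A z i \<inter> A z j = {}"
  shows "\<exists>C. finite C \<and> (\<forall>a\<in>C. \<forall>z. a z < k) \<and> (\<forall>x\<in>S. \<exists>a\<in>C. \<forall>z\<in>Z. x \<notin> A z (a z))
           \<and> real (card C) \<le> r ^ card Z * real (card (shattered A k Z S)) ^ p"
  using \<open>finite Z\<close> disj
proof (induction Z arbitrary: S rule: finite_induct)
  case empty
  show ?case
  proof (cases "S = {}")
    case False
    then have "shattered A k {} S = {{}}" by (auto simp: shattered_def)
    then show ?thesis using \<open>k \<ge> 2\<close> by (intro exI[of _ "{\<lambda>_. 0}"]) auto
  qed (auto intro!: exI[of _ "{}"])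
next
  case (insert z Z)
  let ?D = "\<lambda>i. shattered A k Z (S \<inter> A z i)"
  let ?n = "card (shattered A k (insert z Z) S)"
  define q where "q = (real k + 1) / (real k + 2)"
  have "r \<ge> 1"
  proof -
    have "0 \<le> q ^ p" "q ^ p \<le> r - 1" using r by (simp_all add: q_def)
    then show ?thesis by linarith
  qed
  obtain i where i: "i < k" and i_min: "real (k + 2) * real (card (?D i))
      \<le> real (k + 1) * real (card (\<Union>i<k. ?D i) + card (\<Inter>i<k. ?D i))"
    using card_Union_Inter_ge[of k ?D] finite_shattered[OF \<open>finite Z\<close>] \<open>k \<ge> 2\<close> by force
  note i_min
  also have "real (k + 1) * real (card (\<Union>i<k. ?D i) + card (\<Inter>i<k. ?D i)) \<le> real (k + 1) * real ?n"
    using card_shattered_insert[OF insert.hyps(1,2), of k A S] \<open>k \<ge> 2\<close>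
    by (intro mult_left_mono of_nat_mono) auto
  finally have D_i: "real (card (?D i)) \<le> q * real ?n"
    by (simp add: q_def field_simps)
  have D_diff: "card (shattered A k Z (S - A z i)) \<le> ?n"
    by (intro card_mono finite_shattered shattered_mono) (use insert.hyps in auto)
  \<comment> \<open>Points outside \<open>A z i\<close> may use the label \<open>i\<close> at
    \<open>z\<close>; points inside it need another label \<open>j\<close>, whose set they avoid by
    disjointness.\<close>
  define j :: nat where "j = (if i = 0 then 1 else 0)"
  have j: "j < k" "A z i \<inter> A z j = {}"
    using i \<open>k \<ge> 2\<close> insert.prems[of z i j] by (auto simp: j_def)
  note IH = insert.IH[OF insert.prems, simplified]
  obtain C1 where C1: "finite C1" "\<forall>a\<in>C1. \<forall>z. a z < k"
      "\<forall>x\<in>S - A z i. \<exists>a\<in>C1. \<forall>z\<in>Z. x \<notin> A z (a z)"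
      "real (card C1) \<le> r ^ card Z * real (card (shattered A k Z (S - A z i))) ^ p"
    using IH[of "S - A z i"] by auto
  obtain C2 where C2: "finite C2" "\<forall>a\<in>C2. \<forall>z. a z < k"
      "\<forall>x\<in>S \<inter> A z i. \<exists>a\<in>C2. \<forall>z\<in>Z. x \<notin> A z (a z)"
      "real (card C2) \<le> r ^ card Z * real (card (?D i)) ^ p"
    using IH[of "S \<inter> A z i"] by auto
  define C where "C = (\<lambda>a. a(z := i)) ` C1 \<union> (\<lambda>a. a(z := j)) ` C2"
  have "card C \<le> card C1 + card C2"
    unfolding C_def by (rule order.trans[OF card_Un_le]) (intro add_mono card_image_le C1 C2)
  then have "real (card C) \<le> real (card C1) + real (card C2)" by linarith
  also have "\<dots> \<le> r ^ card Z * real ?n ^ p + r ^ card Z * (q * real ?n) ^ p"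
    using \<open>r \<ge> 1\<close> D_i D_diff
    by (intro add_mono order.trans[OF C1(4)] order.trans[OF C2(4)] mult_left_mono power_mono) auto
  also have "\<dots> = r ^ card Z * (1 + q ^ p) * real ?n ^ p"
    by (simp add: power_mult_distrib algebra_simps)
  also have "\<dots> \<le> r ^ card Z * r * real ?n ^ p"
    using r \<open>r \<ge> 1\<close> by (intro mult_right_mono mult_left_mono) (auto simp: q_def)
  finally have "real (card C) \<le> r ^ card (insert z Z) * real ?n ^ p"
    using insert.hyps by (simp add: mult_ac)
  moreover have "\<exists>a\<in>C. \<forall>w\<in>insert z Z. x \<notin> A w (a w)" if "x \<in> S" for x
  proof (cases "x \<in> A z i")
    case True
    with that have "x \<in> S \<inter> A z i" by simp
    from bspec[OF C2(3) this] obtain a where "a \<in> C2" "\<forall>w\<in>Z. x \<notin> A w (a w)" by (rule bexE)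
    moreover have "x \<notin> A z j" using True j(2) by blast
    ultimately have "\<forall>w\<in>insert z Z. x \<notin> A w ((a(z := j)) w)" by simp
    moreover have "a(z := j) \<in> C" using \<open>a \<in> C2\<close> by (simp add: C_def)
    ultimately show ?thesis by blast
  next
    case False
    with that have "x \<in> S - A z i" by simp
    from bspec[OF C1(3) this] obtain a where "a \<in> C1" "\<forall>w\<in>Z. x \<notin> A w (a w)" by (rule bexE)
    then have "\<forall>w\<in>insert z Z. x \<notin> A w ((a(z := i)) w)" using False by simp
    moreover have "a(z := i) \<in> C" using \<open>a \<in> C1\<close> by (simp add: C_def)
    ultimately show ?thesis by blast
  qed
  moreover have "finite C" "\<forall>a\<in>C. \<forall>w. a w < k"
    using C1 C2 i j by (auto simp: C_def)
  ultimately show ?case by blast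
qed

text \<open>Weight a subset \<open>W\<close> by \<open>y ^ card W\<close>: the total over
  \<open>Pow Z\<close> is \<open>(1 + y) ^ card Z\<close>, and as \<open>y \<le> 1\<close> each
  member of \<open>F\<close> weighs at least \<open>y ^ m\<close>.\<close>

lemma card_small_subsets_le:
  fixes y :: real
  assumes "finite Z" and y: "0 < y" "y \<le> 1" and F: "F \<subseteq> Pow Z" and small: "\<And>W. W \<in> F \<Longrightarrow> card W \<le> m"
  shows "real (card F) * y ^ m \<le> (1 + y) ^ card Z"
proof -
  have "real (card F) * y ^ m = (\<Sum>W\<in>F. y ^ m)" by simp
  also have "\<dots> \<le> (\<Sum>W\<in>F. y ^ card W)"
    using y small by (intro sum_mono power_decreasing) auto
  also have "\<dots> \<le> (\<Sum>W\<in>Pow Z. y ^ card W)"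
    using F \<open>finite Z\<close> y by (intro sum_mono2) auto
  also have "\<dots> = (\<Prod>z\<in>Z. y + 1)"
    using prod_add[OF \<open>finite Z\<close>, of "\<lambda>_. y" "\<lambda>_. 1"] by simp
  finally show ?thesis by (simp add: add.commute)
qed

section \<open>Sets of positive density\<close>

text \<open>The initial windows of the constructed \<open>J\<close> have between
  \<open>d * n\<close> and \<open>\<phi> n\<close> elements, which squeezes the density to
  \<open>d\<close>. Translation is assumed only towards 0, the direction in which independence
  passes over for a map that may not be invertible.\<close>

lemma density_of_hereditary_family:
  fixes P :: "nat set \<Rightarrow> bool" and c :: real
  assumes mono: "\<And>V W. P W \<Longrightarrow> V \<subseteq> W \<Longrightarrow> P V"
    and shift: "\<And>s W. P ((\<lambda>t. t + s) ` W) \<Longrightarrow> P W"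
    and "c > 0"
    and large: "\<And>N. \<exists>n\<ge>N. \<exists>W\<subseteq>{..<n}. P W \<and> c * real n \<le> real (card W)"
  shows "\<exists>J. (\<forall>W\<subseteq>J. finite W \<longrightarrow> P W) \<and> pos_density_nat J"
proof -
  define \<phi> where "\<phi> n = Max (card ` {W. W \<subseteq> {..<n} \<and> P W})" for n
  have "P {}" using large[of 0] mono by blast
  have fin: "finite {W. W \<subseteq> {..<n} \<and> P W}" for n :: nat by simp
  have \<phi>_ge: "card W \<le> \<phi> n" if "W \<subseteq> {..<n}" "P W" for W n
    unfolding \<phi>_def by (intro Max_ge finite_imageI fin) (use that in auto)
  have \<phi>_attained: "\<exists>W\<subseteq>{..<n}. P W \<and> card W = \<phi> n" for n
  proof -
    have "\<phi> n \<in> card ` {W. W \<subseteq> {..<n} \<and> P W}"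
      unfolding \<phi>_def using \<open>P {}\<close> by (intro Max_in finite_imageI fin) auto
    then show ?thesis by auto
  qed
  \<comment> \<open>No element of \<open>W\<close> is below \<open>p\<close>, so truncated
    subtraction is a true translation.\<close>
  have P_down: "P ((\<lambda>t. t - p) ` W)" if "W \<subseteq> {p..<q}" "P W" for p q W
  proof -
    have "(\<lambda>t. t + p) ` (\<lambda>t. t - p) ` W = W"
      using that(1) by (force simp: image_image)
    then show ?thesis using shift[of p "(\<lambda>t. t - p) ` W"] that(2) by simp
  qed
  have card_down: "card ((\<lambda>t. t - p) ` W) = card W" if "W \<subseteq> {p..<q}" for p q :: nat and W
    by (intro card_image inj_onI) (metis that subsetD atLeastLessThan_iff eq_diff_iff)
  have subadd: "\<phi> (m + n) \<le> \<phi> m + \<phi> n" for m n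
  proof -
    obtain W where W: "W \<subseteq> {..<m + n}" "P W" "card W = \<phi> (m + n)"
      using \<phi>_attained by blast
    \<comment> \<open>Cut at \<open>m\<close>; the right-hand piece is moved to the start of a
      window of length \<open>n\<close>.\<close>
    have "W = (W \<inter> {..<m}) \<union> (W \<inter> {m..<m + n})" using W(1) by auto
    then have "card W \<le> card (W \<inter> {..<m}) + card (W \<inter> {m..<m + n})"
      by (metis card_Un_le)
    moreover have "card (W \<inter> {..<m}) \<le> \<phi> m"
      using mono[OF W(2)] by (intro \<phi>_ge) auto
    moreover have "card (W \<inter> {m..<m + n}) \<le> \<phi> n"
    proof -
      have "card ((\<lambda>t. t - m) ` (W \<inter> {m..<m + n})) \<le> \<phi> n"
        using mono[OF W(2)] by (intro \<phi>_ge P_down[of _ m "m + n"]) auto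
      then show ?thesis by (subst (asm) card_down[of _ m "m + n"]) auto
    qed
    ultimately show ?thesis using W(3) by linarith
  qed
  obtain d where d: "(\<lambda>n. real (\<phi> n) / real n) \<longlonglongrightarrow> d" "\<And>n. d * real n \<le> real (\<phi> n)"
    using fekete_subadditive[of "\<lambda>n. real (\<phi> n)"] subadd by (metis of_nat_0_le_iff of_nat_add of_nat_le_iff)
  have "d > 0"
  proof (rule ccontr)
    assume "\<not> d > 0"
    then have "\<forall>\<^sub>F n in sequentially. real (\<phi> n) / real n < c"
      using d(1) \<open>c > 0\<close> by (intro order_tendstoD(2)[of _ d]) auto
    then obtain N where N: "\<And>n. n \<ge> N \<Longrightarrow> real (\<phi> n) / real n < c"
      by (auto simp: eventually_sequentially)
    obtain n W where n: "n \<ge> Suc N" "W \<subseteq> {..<n}" "P W" "c * real n \<le> real (card W)"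
      using large by blast
    have "real (card W) \<le> real (\<phi> n)" using \<phi>_ge n by simp
    then show False using N[of n] n by (simp add: field_simps)
  qed
  \<comment> \<open>Otherwise an almost optimal set could be cut into short intervals of too small density.\<close>
  have leader: "\<exists>W. P W \<and> (\<forall>n\<le>M. (d - 1 / real M) * real n \<le> real (card (W \<inter> {..<n})))"
    if "M > 0" for M
  proof (rule ccontr)
    define e where "e = d - 1 / real M"
    assume "\<not> ?thesis"
    then have bad: "\<exists>n\<le>M. real (card (W \<inter> {..<n})) < e * real n" if "P W" for W
      using that by (force simp: e_def not_le)
    \<comment> \<open>Long enough that the deficit \<open>N / M\<close> exceeds the error
      \<open>M\<close> made on the last block.\<close>
    define N where "N = M * M + 1"
    obtain W where W: "W \<subseteq> {..<N}" "P W" "card W = \<phi> N" using \<phi>_attained by blast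
    \<comment> \<open>\<open>bad\<close> is applied to the piece of \<open>W\<close> in a window of
      length \<open>M\<close>, moved to 0. The strict inequality excludes
      \<open>n = 0\<close>.\<close>
    have step: "\<exists>n>0. n \<le> M \<and> real (card (W \<inter> {p..<p + n})) < e * real n" for p
    proof -
      let ?W = "W \<inter> {p..<p + M}"
      have "P ((\<lambda>t. t - p) ` ?W)" using mono[OF W(2)] by (intro P_down[of _ p "p + M"]) auto
      then obtain n where n: "n \<le> M" "real (card ((\<lambda>t. t - p) ` ?W \<inter> {..<n})) < e * real n"
        using bad by blast
      have "(\<lambda>t. t - p) ` ?W \<inter> {..<n} = (\<lambda>t. t - p) ` (W \<inter> {p..<p + n})"
        using n(1) by auto
      with n(2) have "real (card (W \<inter> {p..<p + n})) < e * real n"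
        by (simp add: card_down[of _ p "p + n"])
      moreover from this have "n > 0" by (cases n) auto
      ultimately show ?thesis using n(1) by blast
    qed
    have "e > 0"
    proof -
      obtain n where "real (card (W \<inter> {0..<0 + n})) < e * real n" using step by blast
      then have "0 < e * real n" by linarith
      then show ?thesis by (auto simp: zero_less_mult_iff)
    qed
    \<comment> \<open>Greedy cutting from left to right: every block has density below
      \<open>e\<close>, and a final stretch of length at most \<open>M\<close> contributes at most
      \<open>M\<close>.\<close>
    have "real (card (W \<inter> {p..<N})) \<le> e * real (N - p) + real M" for p
    proof (induction "N - p" arbitrary: p rule: less_induct)
      case less
      show ?case
      proof (cases "N - p \<le> M")
        case True
        have "card (W \<inter> {p..<N}) \<le> card {p..<N}" by (intro card_mono) auto
        then have "card (W \<inter> {p..<N}) \<le> M" using True by simp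
        moreover have "0 \<le> e * real (N - p)" using \<open>e > 0\<close> by simp
        ultimately show ?thesis by linarith
      next
        case False
        obtain n where n: "n > 0" "n \<le> M" "real (card (W \<inter> {p..<p + n})) < e * real n"
          using step by blast
        have "W \<inter> {p..<N} = (W \<inter> {p..<p + n}) \<union> (W \<inter> {p + n..<N})"
          using n False by auto
        then have "card (W \<inter> {p..<N}) \<le> card (W \<inter> {p..<p + n}) + card (W \<inter> {p + n..<N})"
          by (metis card_Un_le)
        moreover have "real (card (W \<inter> {p + n..<N})) \<le> e * real (N - (p + n)) + real M"
          using n False by (intro less) auto
        moreover have "real (N - p) = real n + real (N - (p + n))" using n False by simp
        ultimately show ?thesis using n(3) by (simp add: distrib_left)
      qed
    qed
    from this[of 0] have "real (\<phi> N) \<le> e * real N + real M"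
      using W by (simp add: atLeast0LessThan Int_absorb2)
    with d(2)[of N] have "real N / real M \<le> real M" by (simp add: e_def algebra_simps)
    then show False using that by (simp add: N_def field_simps)
  qed
  then obtain W where W: "\<And>M. P (W M)"
      "\<And>M n. M > 0 \<Longrightarrow> n \<le> M \<Longrightarrow> (d - 1 / real M) * real n \<le> real (card (W M \<inter> {..<n}))"
  proof -
    have "\<forall>M. \<exists>W. P W \<and> (M > 0 \<longrightarrow> (\<forall>n\<le>M. (d - 1 / real M) * real n \<le> real (card (W \<inter> {..<n}))))"
      using leader \<open>P {}\<close> by blast
    then obtain W where "\<forall>M. P (W M) \<and> (M > 0 \<longrightarrow> (\<forall>n\<le>M. (d - 1 / real M) * real n \<le> real (card (W M \<inter> {..<n}))))"
      by (rule choice[THEN exE])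
    then show ?thesis using that by blast
  qed
  \<comment> \<open>A cluster point of the sequence of these sets in the Cantor space.\<close>
  have "\<exists>B. \<forall>n. infinite {M. W M \<inter> {..<n} = B n} \<and> B (Suc n) \<inter> {..<n} = B n"
  proof (rule dependent_nat_choice)
    show "\<exists>B. infinite {M. W M \<inter> {..<0} = B}"
      by (intro exI[of _ "{}"]) (simp add: infinite_UNIV_nat)
  next
    fix B n assume inf: "infinite {M. W M \<inter> {..<n} = B}"
    \<comment> \<open>Pigeonhole: of the infinitely many sets that agree with \<open>B\<close> below
      \<open>n\<close>, infinitely many also agree on whether \<open>n\<close> belongs to
      them.\<close>
    have "{M. W M \<inter> {..<n} = B}
        \<subseteq> {M. W M \<inter> {..<Suc n} = B} \<union> {M. W M \<inter> {..<Suc n} = insert n B}"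
      by (auto simp: lessThan_Suc)
    then have "infinite {M. W M \<inter> {..<Suc n} = B} \<or> infinite {M. W M \<inter> {..<Suc n} = insert n B}"
      using inf by (meson finite_UnI finite_subset)
    moreover have "B \<subseteq> {..<n}" using inf not_finite_existsD by blast
    ultimately show "\<exists>B'. infinite {M. W M \<inter> {..<Suc n} = B'} \<and> B' \<inter> {..<n} = B"
      by fastforce
  qed
  then obtain B where B: "\<And>n. infinite {M. W M \<inter> {..<n} = B n}" "\<And>n. B (Suc n) \<inter> {..<n} = B n"
    by blast
  define J where "J = (\<Union>n. B n)"
  have B_sub: "B n \<subseteq> {..<n}" for n using B(1)[of n] not_finite_existsD by blast
  have B_restrict: "B (n + m) \<inter> {..<n} = B n" for n m
  proof (induction m)
    case 0
    show ?case using B_sub[of n] by auto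
  next
    case (Suc m)
    have "B (n + Suc m) \<inter> {..<n} = B (Suc (n + m)) \<inter> {..<n + m} \<inter> {..<n}" by auto
    then show ?case using Suc B(2)[of "n + m"] by simp
  qed
  have J_restrict: "J \<inter> {..<n} = B n" for n
  proof
    show "B n \<subseteq> J \<inter> {..<n}" using B_sub by (auto simp: J_def)
    show "J \<inter> {..<n} \<subseteq> B n"
    proof
      fix t assume "t \<in> J \<inter> {..<n}"
      then obtain m where m: "t \<in> B m" "t < n" by (auto simp: J_def)
      show "t \<in> B n"
      proof (cases "n \<le> m")
        case True
        then show ?thesis using B_restrict[of n "m - n"] m by auto
      next
        case False
        then show ?thesis using B_restrict[of m "n - m"] m by auto
      qed
    qed
  qed
  have restrict_large: "\<exists>M>N. W M \<inter> {..<n} = J \<inter> {..<n}" for n N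
    using B(1)[of n] unfolding J_restrict infinite_nat_iff_unbounded by blast
  have P_J: "P (J \<inter> {..<n})" for n
    using restrict_large[of 0 n] mono[OF W(1)] by (metis Int_lower1)
  have lower: "d * real n \<le> real (card (J \<inter> {..<n}))" for n
  proof (rule field_le_epsilon)
    fix e :: real assume "e > 0"
    \<comment> \<open>With \<open>n\<close> fixed, a large index \<open>M\<close> makes the defect
      \<open>n / M\<close> at most \<open>e\<close>.\<close>
    obtain K where K: "real n / e < real K" using reals_Archimedean2 by blast
    obtain M where M: "M > max n K" "W M \<inter> {..<n} = J \<inter> {..<n}"
      using restrict_large by blast
    then have "(d - 1 / real M) * real n \<le> real (card (J \<inter> {..<n}))"
      using W(2)[of M n] by auto
    moreover have "real n / real M \<le> e"
    proof -
      have "real n / e < real M" using K M(1) by linarith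
      then show ?thesis using \<open>e > 0\<close> M(1) by (simp add: field_simps)
    qed
    ultimately show "d * real n \<le> real (card (J \<inter> {..<n})) + e"
      by (simp add: algebra_simps)
  qed
  have upper: "real (card (J \<inter> {..<n})) \<le> real (\<phi> n)" for n
    using \<phi>_ge[OF _ P_J] by simp
  have "(\<lambda>n. real (card (J \<inter> {..<n})) / real n) \<longlonglongrightarrow> d"
  proof (rule tendsto_sandwich[OF _ _ tendsto_const d(1)])
    show "\<forall>\<^sub>F n in sequentially. d \<le> real (card (J \<inter> {..<n})) / real n"
      using eventually_gt_at_top[of 0] by eventually_elim (use lower in \<open>simp add: field_simps\<close>)
    show "\<forall>\<^sub>F n in sequentially. real (card (J \<inter> {..<n})) / real n \<le> real (\<phi> n) / real n"
      using upper by (intro always_eventually allI divide_right_mono) auto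
  qed
  \<comment> \<open>Density is measured on \<open>{0..n}\<close>, which is the window
    \<open>{..<Suc n}\<close>; hence the index shift.\<close>
  from LIMSEQ_Suc[OF this] have "pos_density_nat J"
    using \<open>d > 0\<close> unfolding pos_density_nat_def
    by (intro exI[of _ d]) (simp add: lessThan_Suc_atMost atLeast0AtMost)
  moreover have "P V" if "V \<subseteq> J" "finite V" for V
  proof -
    obtain n where "V \<subseteq> {..<n}" using \<open>finite V\<close> finite_nat_iff_bounded by blast
    then show ?thesis using mono[OF P_J[of n]] that by blast
  qed
  ultimately show ?thesis by blast
qed

section \<open>Entropy of covers and independence sets\<close>

lemma indep_set_nat_mono: "indep_set_nat T k A W \<Longrightarrow> V \<subseteq> W \<Longrightarrow> indep_set_nat T k A V"
  unfolding indep_set_nat_def by (meson order.trans)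

text \<open>A point realising a pattern at the times \<open>t + s\<close> is moved by
  \<open>T ^^ s\<close> to one realising it at the times \<open>t\<close>.\<close>

lemma indep_set_nat_shift:
  assumes "indep_set_nat T k A ((\<lambda>t. t + s) ` W)"
  shows "indep_set_nat T k A W"
  unfolding indep_set_nat_def
proof (intro allI impI)
  fix I and \<sigma> :: "nat \<Rightarrow> nat"
  assume I: "I \<subseteq> W \<and> finite I \<and> I \<noteq> {} \<and> (\<forall>t\<in>I. \<sigma> t < k)"
  have "(\<Inter>t\<in>(\<lambda>t. t + s) ` I. (T ^^ t) -` A (\<sigma> (t - s))) \<noteq> {}"
    using assms[unfolded indep_set_nat_def, rule_format, of "(\<lambda>t. t + s) ` I" "\<lambda>t. \<sigma> (t - s)"] I
    by fastforce
  then obtain y where "\<forall>t\<in>I. (T ^^ (t + s)) y \<in> A (\<sigma> t)" by auto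
  then have "(T ^^ s) y \<in> (\<Inter>t\<in>I. (T ^^ t) -` A (\<sigma> t))" by (simp add: funpow_add)
  then show "(\<Inter>t\<in>I. (T ^^ t) -` A (\<sigma> t)) \<noteq> {}" by blast
qed

text \<open>Members of the joined cover are recorded by the choices \<open>a\<close> defining them,
  which are easier to count and concatenate than sets. Values of \<open>a\<close> from index
  \<open>n\<close> on are arbitrary.\<close>

definition itinerary_cover :: "('a \<Rightarrow> 'a) \<Rightarrow> 'a set set \<Rightarrow> nat \<Rightarrow> (nat \<Rightarrow> 'a set) set \<Rightarrow> bool" where
  "itinerary_cover T U n C \<longleftrightarrow> finite C \<and> (\<forall>a\<in>C. \<forall>i<n. a i \<in> U)
     \<and> (\<forall>x. \<exists>a\<in>C. \<forall>i<n. (T ^^ i) x \<in> a i)"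

lemma cover_number_le_itinerary_cover:
  assumes "itinerary_cover T U n C"
  shows "cover_number (join_cover T U n) \<le> card C"
proof -
  let ?V = "(\<lambda>a. \<Inter>i\<in>{..<n}. (T ^^ i) -` a i) ` C"
  have "?V \<subseteq> join_cover T U n"
  proof (rule image_subsetI)
    fix a assume "a \<in> C"
    then show "(\<Inter>i\<in>{..<n}. (T ^^ i) -` a i) \<in> join_cover T U n"
      using assms unfolding join_cover_def itinerary_cover_def by (intro CollectI exI[of _ a]) auto
  qed
  moreover have "\<Union>?V = UNIV" "finite ?V"
    using assms unfolding itinerary_cover_def set_eq_iff UN_iff INT_iff vimage_eq lessThan_iff Ball_def
    by (simp_all add: Bex_def)
  ultimately have "cover_number (join_cover T U n) \<le> card ?V"
    unfolding cover_number_def by (intro Least_le) blast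
  also have "\<dots> \<le> card C" using assms by (intro card_image_le) (simp add: itinerary_cover_def)
  finally show ?thesis .
qed

text \<open>The finitely many itineraries through \<open>U\<close> yield a finite subcover, so the
  \<open>LEAST\<close> in \<open>cover_number\<close> is a genuine minimum; one itinerary is then
  chosen for each member of an optimal subcover.\<close>

lemma itinerary_cover_attained:
  assumes "finite U" "\<Union>U = UNIV"
  shows "\<exists>C. itinerary_cover T U n C \<and> card C = cover_number (join_cover T U n)"
proof -
  define h where "h a = (\<Inter>i\<in>{..<n}. (T ^^ i) -` a i)" for a :: "nat \<Rightarrow> 'a set"
  let ?P = "PiE {..<n} (\<lambda>_. U)"
  have "finite (h ` ?P)" using assms by (intro finite_imageI finite_PiE) auto
  moreover have "h ` ?P \<subseteq> join_cover T U n"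
  proof (intro image_subsetI)
    fix a assume "a \<in> ?P"
    then show "h a \<in> join_cover T U n"
      unfolding join_cover_def h_def by (intro CollectI exI[of _ a]) auto
  qed
  moreover have "x \<in> \<Union>(h ` ?P)" for x
  proof -
    have "\<forall>i. \<exists>A\<in>U. (T ^^ i) x \<in> A" using assms(2) by blast
    then obtain a where "\<forall>i. a i \<in> U \<and> (T ^^ i) x \<in> a i" by metis
    then have "x \<in> h (restrict a {..<n})" "restrict a {..<n} \<in> ?P" by (auto simp: h_def)
    then show ?thesis by blast
  qed
  ultimately have "\<exists>m. \<exists>V\<subseteq>join_cover T U n. finite V \<and> card V = m \<and> \<Union>V = UNIV"
    by (intro exI[of _ "card (h ` ?P)"] exI[of _ "h ` ?P"]) blast
  from LeastI_ex[OF this] obtain V where V: "V \<subseteq> join_cover T U n" "finite V"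
      "card V = cover_number (join_cover T U n)" "\<Union>V = UNIV"
    unfolding cover_number_def by blast
  have "\<forall>B\<in>V. \<exists>a. (\<forall>i<n. a i \<in> U) \<and> h a = B"
    using V(1) unfolding join_cover_def h_def by blast
  from bchoice[OF this] obtain f where f: "\<forall>B\<in>V. (\<forall>i<n. f B i \<in> U) \<and> h (f B) = B" by (rule exE)
  have "\<exists>a\<in>f ` V. \<forall>i<n. (T ^^ i) x \<in> a i" for x
  proof -
    have "x \<in> \<Union>V" by (simp add: V(4))
    then obtain B where "x \<in> B" "B \<in> V" by (rule UnionE)
    then have "x \<in> h (f B)" using f by simp
    then have "\<forall>i<n. (T ^^ i) x \<in> f B i" by (simp add: h_def)
    then show ?thesis using \<open>B \<in> V\<close> by (intro bexI[of _ "f B"]) simp_all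
  qed
  then have cov: "itinerary_cover T U n (f ` V)"
    using V(2) f by (auto simp: itinerary_cover_def)
  \<comment> \<open>Passing to the image under \<open>f\<close> cannot increase the cardinality, and
    the minimum cannot be undercut.\<close>
  moreover have "card (f ` V) = cover_number (join_cover T U n)"
    using cover_number_le_itinerary_cover[OF cov] card_image_le[OF V(2), of f] V(3) by linarith
  ultimately show ?thesis by blast
qed

text \<open>The space has a point, so the empty family covers nothing. This keeps the logarithms
  nonnegative.\<close>

lemma cover_number_join_pos:
  assumes "finite U" "\<Union>U = UNIV"
  shows "cover_number (join_cover T U n) \<ge> 1"
proof -
  obtain C where "itinerary_cover T U n C" "card C = cover_number (join_cover T U n)"
    using itinerary_cover_attained[OF assms] by blast
  moreover from this have "C \<noteq> {}" "finite C" by (auto simp: itinerary_cover_def)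
  ultimately show ?thesis by (metis One_nat_def Suc_leI card_gt_0_iff)
qed

text \<open>Follow an itinerary of \<open>x\<close> for \<open>m\<close> steps, then one of
  \<open>(T ^^ m) x\<close>.\<close>

lemma cover_number_join_submult:
  assumes "finite U" "\<Union>U = UNIV"
  shows "cover_number (join_cover T U (m + n))
           \<le> cover_number (join_cover T U m) * cover_number (join_cover T U n)"
proof -
  obtain C1 where C1: "itinerary_cover T U m C1" "card C1 = cover_number (join_cover T U m)"
    using itinerary_cover_attained[OF assms] by blast
  obtain C2 where C2: "itinerary_cover T U n C2" "card C2 = cover_number (join_cover T U n)"
    using itinerary_cover_attained[OF assms] by blast
  define g where "g = (\<lambda>(a, b) i. if i < m then a i else b (i - m) :: 'a set)"
  have "\<exists>c\<in>g ` (C1 \<times> C2). \<forall>i<m + n. (T ^^ i) x \<in> c i" for x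
  proof -
    obtain a where a: "a \<in> C1" "\<forall>i<m. (T ^^ i) x \<in> a i"
      using C1 unfolding itinerary_cover_def by blast
    obtain b where b: "b \<in> C2" "\<forall>i<n. (T ^^ i) ((T ^^ m) x) \<in> b i"
      using C2 unfolding itinerary_cover_def by blast
    have "(T ^^ i) x \<in> g (a, b) i" if "i < m + n" for i
    proof (cases "i < m")
      case False
      then have "(T ^^ i) x = (T ^^ (i - m)) ((T ^^ m) x)"
        by (simp flip: funpow_add[unfolded comp_def fun_eq_iff, rule_format])
      then show ?thesis using False b(2) that by (simp add: g_def)
    qed (use a in \<open>simp add: g_def\<close>)
    then show ?thesis using a(1) b(1) by blast
  qed
  then have "itinerary_cover T U (m + n) (g ` (C1 \<times> C2))"
    using C1(1) C2(1) by (auto simp: itinerary_cover_def g_def)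
  then have "cover_number (join_cover T U (m + n)) \<le> card (g ` (C1 \<times> C2))"
    by (rule cover_number_le_itinerary_cover)
  also have "\<dots> \<le> card (C1 \<times> C2)"
    using C1(1) C2(1) by (intro card_image_le) (auto simp: itinerary_cover_def)
  finally show ?thesis by (simp add: card_cartesian_product C1(2) C2(2))
qed

text \<open>A \<open>lim\<close> can be estimated only once convergence is known;
  submultiplicativity and Fekete supply it.\<close>

lemma cover_entropy_LIMSEQ:
  assumes "finite U" "\<Union>U = UNIV"
  shows "(\<lambda>n. ln (real (cover_number (join_cover T U n))) / real n) \<longlonglongrightarrow> cover_entropy T U"
proof -
  let ?N = "\<lambda>n. cover_number (join_cover T U n)"
  have pos: "?N n \<ge> 1" for n by (rule cover_number_join_pos[OF assms])
  obtain L where "(\<lambda>n. ln (real (?N n)) / real n) \<longlonglongrightarrow> L"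
  proof (rule fekete_subadditive[of "\<lambda>n. ln (real (?N n))"])
    show "0 \<le> ln (real (?N n))" for n using pos[of n] by simp
    show "ln (real (?N (m + n))) \<le> ln (real (?N m)) + ln (real (?N n))" for m n
    proof -
      have "ln (real (?N (m + n))) \<le> ln (real (?N m * ?N n))"
        using cover_number_join_submult[OF assms, of T m n] pos[of "m + n"]
        by (intro ln_mono) (auto simp del: of_nat_mult)
      also have "\<dots> = ln (real (?N m)) + ln (real (?N n))"
        using pos[of m] pos[of n] by (simp add: ln_mult)
      finally show ?thesis .
    qed
  qed
  then show ?thesis unfolding cover_entropy_def by (metis limI)
qed

section \<open>Positive entropy and independence sets of linear size\<close>

lemma Union_complements:
  assumes "i < k" "j < k" "V i \<inter> V j = {}"
  shows "\<Union>{- V i | i. i < k} = UNIV"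
  using assms by blast

text \<open>At each time in \<open>I\<close> an itinerary rules out an index, so at most
  \<open>(k - 1) ^ card I\<close> patterns are compatible with it. One such index
  \<open>b a s\<close> is chosen, since sets \<open>V i\<close> of equal points coincide.\<close>

lemma indep_set_card_le_itinerary_cover:
  assumes "itinerary_cover T {- V i | i. i < k} n C" and "indep_set_nat T k V I" and "I \<subseteq> {..<n}"
  shows "k ^ card I \<le> card C * (k - 1) ^ card I"
proof -
  have "finite I" "finite C"
    using assms finite_subset by (auto simp: itinerary_cover_def)
  have "\<forall>a\<in>C. \<forall>s\<in>I. \<exists>j<k. a s = - V j"
    using assms unfolding itinerary_cover_def by blast
  then obtain b where b: "\<And>a s. a \<in> C \<Longrightarrow> s \<in> I \<Longrightarrow> b a s < k \<and> a s = - V (b a s)" by metis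
  have "PiE I (\<lambda>_. {..<k}) \<subseteq> (\<Union>a\<in>C. PiE I (\<lambda>s. {..<k} - {b a s}))"
  proof
    fix \<sigma> assume \<sigma>: "\<sigma> \<in> PiE I (\<lambda>_. {..<k})"
    \<comment> \<open>\<open>indep_set_nat\<close> speaks only of nonempty index sets; for empty
      \<open>I\<close> any point serves.\<close>
    obtain y where y: "\<forall>s\<in>I. (T ^^ s) y \<in> V (\<sigma> s)"
    proof (cases "I = {}")
      case False
      have "(\<Inter>s\<in>I. (T ^^ s) -` V (\<sigma> s)) \<noteq> {}"
        using assms(2)[unfolded indep_set_nat_def, rule_format, of I \<sigma>] \<sigma> False \<open>finite I\<close>
        by (auto dest: PiE_mem)
      then show ?thesis using that by blast
    qed (use that in auto)
    obtain a where a: "a \<in> C" "\<forall>i<n. (T ^^ i) y \<in> a i"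
      using assms(1) unfolding itinerary_cover_def by blast
    have "\<sigma> s \<noteq> b a s" if "s \<in> I" for s
      using y a b[OF a(1) that] that assms(3) by (metis ComplD lessThan_iff subsetD)
    then have "\<sigma> \<in> PiE I (\<lambda>s. {..<k} - {b a s})"
      using \<sigma> by (auto simp: PiE_iff)
    then show "\<sigma> \<in> (\<Union>a\<in>C. PiE I (\<lambda>s. {..<k} - {b a s}))" using a(1) by blast
  qed
  then have "card (PiE I (\<lambda>_. {..<k})) \<le> card (\<Union>a\<in>C. PiE I (\<lambda>s. {..<k} - {b a s}))"
    using \<open>finite C\<close> \<open>finite I\<close> by (intro card_mono) (auto intro!: finite_PiE)
  also have "\<dots> \<le> (\<Sum>a\<in>C. card (PiE I (\<lambda>s. {..<k} - {b a s})))"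
    by (rule card_UN_le[OF \<open>finite C\<close>])
  also have "\<dots> = (\<Sum>a\<in>C. (k - 1) ^ card I)"
    using \<open>finite I\<close> b by (intro sum.cong refl) (simp add: card_PiE card_Diff_singleton)
  finally show ?thesis using \<open>finite I\<close> by (simp add: card_PiE)
qed

text \<open>Counting patterns makes the cover number at least \<open>(k / (k - 1)) ^ card I\<close>
  for arbitrarily large \<open>n\<close>. As the entropy limit exists, infinitely many
  \<open>n\<close> suffice to bound it away from 0.\<close>

lemma cover_entropy_pos_if_indep:
  assumes "k \<ge> 2" and cov: "\<Union>{- V i | i. i < k} = UNIV" and "c > 0"
    and large: "\<And>N. \<exists>n\<ge>N. \<exists>I\<subseteq>{..<n}. indep_set_nat T k V I \<and> c * real n \<le> real (card I)"
  shows "cover_entropy T {- V i | i. i < k} > 0"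
proof (rule ccontr)
  let ?U = "{- V i | i. i < k}"
  let ?N = "\<lambda>n. cover_number (join_cover T ?U n)"
  define b where "b = ln (real k / real (k - 1))"
  have "b > 0" using \<open>k \<ge> 2\<close> by (simp add: b_def)
  assume "\<not> ?thesis"
  then have "\<forall>\<^sub>F n in sequentially. ln (real (?N n)) / real n < c * b"
    using cover_entropy_LIMSEQ[OF _ cov, of T] \<open>c > 0\<close> \<open>b > 0\<close>
    by (intro order_tendstoD[of _ "cover_entropy T ?U"]) (auto simp: not_less intro: le_less_trans)
  then obtain N where N: "\<And>n. n \<ge> N \<Longrightarrow> ln (real (?N n)) / real n < c * b"
    by (auto simp: eventually_sequentially)
  obtain n I where n: "n \<ge> Suc N" "I \<subseteq> {..<n}" "indep_set_nat T k V I" "c * real n \<le> real (card I)"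
    using large by blast
  obtain C where C: "itinerary_cover T ?U n C" "card C = ?N n"
    using itinerary_cover_attained[OF _ cov, of T n] by auto
  have "real k ^ card I \<le> real (?N n) * real (k - 1) ^ card I"
    using indep_set_card_le_itinerary_cover[OF C(1) n(3,2)] C(2)
    by (metis of_nat_le_iff of_nat_mult of_nat_power)
  then have "(real k / real (k - 1)) ^ card I \<le> real (?N n)"
    using \<open>k \<ge> 2\<close> by (simp add: power_divide divide_le_eq)
  then have "ln ((real k / real (k - 1)) ^ card I) \<le> ln (real (?N n))"
    using \<open>k \<ge> 2\<close> by (intro ln_mono) auto
  then have "real (card I) * b \<le> ln (real (?N n))"
    using \<open>k \<ge> 2\<close> by (simp add: b_def ln_realpow)
  moreover have "c * real n * b \<le> real (card I) * b"
    using n(4) \<open>b > 0\<close> by (intro mult_right_mono) auto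
  ultimately have "c * b \<le> ln (real (?N n)) / real n"
    using n(1) by (simp add: field_simps)
  then show False using N[of n] n(1) by simp
qed

lemma shattered_imp_indep_set_nat:
  assumes "W \<in> shattered (\<lambda>z i. (T ^^ z) -` A i) k Z S" and "k > 0"
  shows "indep_set_nat T k A W"
  unfolding indep_set_nat_def
proof (intro allI impI)
  fix I and \<sigma> :: "nat \<Rightarrow> nat"
  assume I: "I \<subseteq> W \<and> finite I \<and> I \<noteq> {} \<and> (\<forall>s\<in>I. \<sigma> s < k)"
  \<comment> \<open>Shattering asks for labels on all of \<open>W\<close>, so the pattern is
    extended by the default label 0.\<close>
  define \<tau> where "\<tau> s = (if s \<in> I then \<sigma> s else 0)" for s
  have "\<forall>s\<in>W. \<tau> s < k" using I \<open>k > 0\<close> by (auto simp: \<tau>_def)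
  then have "S \<inter> (\<Inter>s\<in>W. (T ^^ s) -` A (\<tau> s)) \<noteq> {}"
    using assms(1) unfolding shattered_def by blast
  then obtain y where "\<forall>s\<in>W. (T ^^ s) y \<in> A (\<tau> s)" by auto
  then have "y \<in> (\<Inter>s\<in>I. (T ^^ s) -` A (\<sigma> s))" using I by (auto simp: \<tau>_def dest!: bspec)
  then show "(\<Inter>s\<in>I. (T ^^ s) -` A (\<sigma> s)) \<noteq> {}" by blast
qed

text \<open>The covering bound turns entropy into exponentially many shattered sets, and a window
  has too few small subsets for all of them to be small.\<close>

lemma indep_if_cover_entropy_pos:
  assumes "l \<ge> 2" and disj: "\<And>i j. i < l \<Longrightarrow> j < l \<Longrightarrow> i \<noteq> j \<Longrightarrow> A i \<inter> A j = {}"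
    and pos: "cover_entropy T {- A i | i. i < l} > 0"
  shows "\<exists>c>0. \<forall>N. \<exists>n\<ge>N. \<exists>W\<subseteq>{..<n}. indep_set_nat T l A W \<and> c * real n \<le> real (card W)"
proof -
  let ?U = "{- A i | i. i < l}"
  let ?N = "\<lambda>n. cover_number (join_cover T ?U n)"
  have cov: "\<Union>?U = UNIV" using disj[of 0 1] \<open>l \<ge> 2\<close> by (intro Union_complements[of 0 l 1]) auto
  define b where "b = cover_entropy T ?U / 2"
  have "b > 0" using pos by (simp add: b_def)
  have "\<forall>\<^sub>F n in sequentially. b < ln (real (?N n)) / real n"
    using pos by (intro order_tendstoD(1)[OF cover_entropy_LIMSEQ[OF _ cov, of T]]) (auto simp: b_def)
  then obtain N0 where N0: "\<And>n. n \<ge> N0 \<Longrightarrow> b < ln (real (?N n)) / real n"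
    by (auto simp: eventually_sequentially)
  \<comment> \<open>Half of the rate \<open>b\<close> is spent on the factor \<open>r ^ n\<close>;
    the other half is left for the number of shattered sets.\<close>
  define r where "r = exp (b / 2)"
  define q where "q = (real l + 1) / (real l + 2)"
  have "r - 1 > 0" using \<open>b > 0\<close> by (simp add: r_def)
  obtain p0 where "q ^ p0 < r - 1"
    using real_arch_pow_inv[OF \<open>r - 1 > 0\<close>, of q] by (auto simp: q_def)
  moreover have "q ^ Suc p0 \<le> q ^ p0"
    by (intro power_decreasing) (auto simp: q_def)
  ultimately have p: "q ^ Suc p0 \<le> r - 1" by linarith
  \<comment> \<open>A successor, so that \<open>p\<close>-th roots can be taken below.\<close>
  define p where "p = Suc p0"
  \<comment> \<open>\<open>\<beta>\<close> is the growth rate forced on the number of shattered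
    sets. The choice of \<open>y\<close> makes \<open>(1 + y) ^ n\<close> at most
    \<open>exp (\<beta> / 2 * n)\<close>, and that of \<open>c\<close> makes \<open>y ^ m\<close> at
    least \<open>exp (- (\<beta> / 4) * n)\<close> for \<open>m \<le> c * n\<close>. The summand 1
    in \<open>1 - ln y\<close> keeps the denominator positive when \<open>y = 1\<close>.\<close>
  define \<beta> where "\<beta> = b / (2 * real p)"
  define y where "y = min 1 (\<beta> / 2)"
  define c where "c = \<beta> / (4 * (1 - ln y))"
  have "\<beta> > 0" using \<open>b > 0\<close> by (simp add: \<beta>_def p_def)
  then have y: "0 < y" "y \<le> 1" "y \<le> \<beta> / 2" by (auto simp: y_def)
  then have ln_y: "ln y \<le> 0" by simp
  then have "c > 0" using \<open>\<beta> > 0\<close> by (simp add: c_def)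
  have c: "c * (- ln y) \<le> \<beta> / 4"
  proof -
    have "c * (- ln y) \<le> c * (1 - ln y)" using \<open>c > 0\<close> by (intro mult_left_mono) auto
    also have "\<dots> = \<beta> / 4" using ln_y unfolding c_def by (subst times_divide_eq_left, subst nonzero_divide_eq_eq) auto
    finally show ?thesis .
  qed
  have "\<exists>W\<subseteq>{..<n}. indep_set_nat T l A W \<and> c * real n \<le> real (card W)" if "n \<ge> max 1 N0" for n
  proof (rule ccontr)
    assume none: "\<not> ?thesis"
    define D where "D = shattered (\<lambda>z i. (T ^^ z) -` A i) l {..<n} UNIV"
    have "(T ^^ z) -` A i \<inter> (T ^^ z) -` A j = {}" if "i < l" "j < l" "i \<noteq> j" for z i j
      using disj[OF that] by blast
    then obtain C where C: "finite C" "\<forall>a\<in>C. \<forall>z. a z < l"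
        "\<forall>x\<in>UNIV. \<exists>a\<in>C. \<forall>z\<in>{..<n}. x \<notin> (T ^^ z) -` A (a z)"
        "real (card C) \<le> r ^ card {..<n} * real (card D) ^ p"
      using cover_card_le_shattered[OF \<open>l \<ge> 2\<close> p[unfolded q_def, folded p_def],
          of "{..<n}" "\<lambda>z i. (T ^^ z) -` A i" UNIV, folded D_def]
      by (metis finite_lessThan)
    have "itinerary_cover T ?U n ((\<lambda>a z. - A (a z)) ` C)"
      unfolding itinerary_cover_def
    proof (intro conjI allI ballI impI)
      fix x
      from bspec[OF C(3) UNIV_I[of x]] obtain a where "a \<in> C" "\<forall>z\<in>{..<n}. x \<notin> (T ^^ z) -` A (a z)"
        by (rule bexE)
      then show "\<exists>a\<in>(\<lambda>a z. - A (a z)) ` C. \<forall>i<n. (T ^^ i) x \<in> a i"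
        by (intro bexI[of _ "\<lambda>z. - A (a z)"]) auto
    qed (use C(1,2) in auto)
    then have "?N n \<le> card ((\<lambda>a z. - A (a z)) ` C)"
      by (rule cover_number_le_itinerary_cover)
    also have "\<dots> \<le> card C" by (rule card_image_le[OF C(1)])
    finally have "real (?N n) \<le> r ^ n * real (card D) ^ p" using C(4) by simp
    moreover have "exp (b * real n) \<le> real (?N n)"
    proof -
      have "b * real n \<le> ln (real (?N n))" using N0[of n] that by (simp add: field_simps)
      then show ?thesis using cover_number_join_pos[OF _ cov, of T n] by (simp add: ln_ge_iff)
    qed
    moreover have "exp (b * real n) = r ^ n * exp (\<beta> * real n) ^ p"
      by (simp add: r_def \<beta>_def p_def field_simps flip: exp_of_nat_mult exp_add del: power_Suc)
    ultimately have "r ^ n * exp (\<beta> * real n) ^ p \<le> r ^ n * real (card D) ^ p" by linarith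
    then have "exp (\<beta> * real n) ^ p \<le> real (card D) ^ p" by (simp add: r_def)
    then have D_ge: "exp (\<beta> * real n) \<le> real (card D)"
      unfolding p_def by (rule power_le_imp_le_base) simp
    define m where "m = nat \<lfloor>c * real n\<rfloor>"
    have m: "real m \<le> c * real n" using \<open>c > 0\<close> by (simp add: m_def)
    have "card W \<le> m" if "W \<in> D" for W
    proof -
      have "W \<subseteq> {..<n}" using that by (auto simp: D_def shattered_def)
      moreover have "indep_set_nat T l A W"
        using shattered_imp_indep_set_nat that \<open>l \<ge> 2\<close> unfolding D_def by fastforce
      ultimately have "real (card W) \<le> c * real n" using none by force
      then show ?thesis unfolding m_def by (rule le_nat_floor)
    qed
    then have "real (card D) * y ^ m \<le> (1 + y) ^ n"
      using card_small_subsets_le[of "{..<n}" y D m] y by (auto simp: D_def shattered_def)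
    moreover have "(1 + y) ^ n \<le> exp (\<beta> / 2 * real n)"
    proof -
      have "1 + y \<le> exp y" by (rule exp_ge_add_one_self)
      also have "\<dots> \<le> exp (\<beta> / 2)" using y by simp
      finally have "(1 + y) ^ n \<le> exp (\<beta> / 2) ^ n" using y by (intro power_mono) auto
      then show ?thesis by (simp add: mult.commute flip: exp_of_nat_mult)
    qed
    moreover have "exp (- (\<beta> / 4) * real n) \<le> y ^ m"
    proof -
      have "real m * (- ln y) \<le> c * real n * (- ln y)"
        using m ln_y by (intro mult_right_mono) auto
      also have "\<dots> \<le> \<beta> / 4 * real n"
        using mult_right_mono[OF c, of "real n"] by (simp add: mult_ac)
      finally have "- (\<beta> / 4) * real n \<le> real m * ln y" by simp
      then have "exp (- (\<beta> / 4) * real n) \<le> exp (real m * ln y)" by simp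
      also have "\<dots> = y ^ m" using y by (simp add: exp_of_nat_mult)
      finally show ?thesis .
    qed
    moreover have "exp (\<beta> * real n) * exp (- (\<beta> / 4) * real n) \<le> real (card D) * y ^ m"
      by (intro mult_mono D_ge calculation) auto
    \<comment> \<open>The left side grows at rate \<open>3 * \<beta> / 4\<close>, the right side
      only at rate \<open>\<beta> / 2\<close>.\<close>
    ultimately have "exp (\<beta> * real n) * exp (- (\<beta> / 4) * real n) \<le> exp (\<beta> / 2 * real n)"
      by linarith
    then have "\<beta> * real n + - (\<beta> / 4) * real n \<le> \<beta> / 2 * real n"
      by (simp only: exp_le_cancel_iff flip: exp_add)
    moreover have "\<beta> * real n > 0" using \<open>\<beta> > 0\<close> that by simp
    ultimately show False by (simp add: field_simps)
  qed
  then show ?thesis using \<open>c > 0\<close> by (meson max.cobounded1 max.cobounded2 order.trans)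
qed

section \<open>Entropy tuples and IE-tuples\<close>

text \<open>The separating pair chosen for \<open>(p, q)\<close> need not mirror the one for
  \<open>(q, p)\<close>, so \<open>G p\<close> is cut down by \<open>f p q\<close> as well as by
  \<open>g q p\<close>.\<close>

lemma separate_finite_points:
  fixes P :: "'a::t2_space set"
  assumes "finite P"
  shows "\<exists>G. (\<forall>p\<in>P. open (G p) \<and> p \<in> G p) \<and> (\<forall>p\<in>P. \<forall>q\<in>P. p \<noteq> q \<longrightarrow> G p \<inter> G q = {})"
proof -
  have "\<forall>p q :: 'a. \<exists>U V. p \<noteq> q \<longrightarrow> open U \<and> open V \<and> p \<in> U \<and> q \<in> V \<and> U \<inter> V = {}"
    by (metis hausdorff)
  then obtain f g where fg: "\<And>p q :: 'a. p \<noteq> q \<Longrightarrow>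
      open (f p q) \<and> open (g p q) \<and> p \<in> f p q \<and> q \<in> g p q \<and> f p q \<inter> g p q = {}"
    by metis
  define G where "G p = (\<Inter>q\<in>P - {p}. f p q \<inter> g q p)" for p
  have "open (G p) \<and> p \<in> G p" for p
    unfolding G_def
  proof (intro conjI open_INT INT_I ballI)
    fix q assume "q \<in> P - {p}"
    then have "p \<noteq> q" "q \<noteq> p" by auto
    then show "open (f p q \<inter> g q p)" "p \<in> f p q \<inter> g q p" using fg by blast+
  qed (use assms in auto)
  moreover have "G p \<inter> G q = {}" if "p \<in> P" "q \<in> P" "p \<noteq> q" for p q
  proof -
    have "G p \<subseteq> f p q" "G q \<subseteq> g p q" using that by (auto simp: G_def)
    then show ?thesis using fg[OF that(3)] by blast
  qed
  ultimately show ?thesis by blast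
qed

text \<open>Regularity of compact Hausdorff spaces: separate \<open>p\<close> from the compact set
  \<open>- G\<close> and take the complement of the outer open set.\<close>

lemma compact_t2_closed_neighbourhood:
  fixes G :: "'a::t2_space set"
  assumes "compact (UNIV :: 'a set)" "open G" "p \<in> G"
  shows "\<exists>V. closed V \<and> p \<in> interior V \<and> V \<subseteq> G"
proof -
  have "compact (- G)"
    using compact_Int_closed[OF assms(1), of "- G"] assms(2) by (simp add: closed_Compl)
  moreover have "Hausdorff_space (euclidean :: 'a topology)"
    using hausdorff by (fastforce simp: Hausdorff_space_def disjnt_def)
  ultimately obtain U H where "openin euclidean U" "openin euclidean H" "{p} \<subseteq> U" "- G \<subseteq> H" "disjnt U H"
    using assms(3) by (elim Hausdorff_space_compact_separation[of euclidean "{p}" "- G"]) (auto simp: disjnt_def)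
  then have "open U" "open H" "p \<in> U" "- G \<subseteq> H" "U \<inter> H = {}"
    by (auto simp: disjnt_def)
  then show ?thesis
    by (intro exI[of _ "- H"]) (auto simp: interior_def)
qed

text \<open>The given neighbourhoods may overlap and differ at repeated points. They are shrunk to
  disjoint closed ones indexed by the distinct points, and patterns for the tuple are read as
  patterns for those points.\<close>

lemma entropy_tuple_imp_IE_tuple_nat:
  fixes T :: "'a::t2_space \<Rightarrow> 'a"
  assumes "compact (UNIV :: 'a set)" and "entropy_tuple T k x"
  shows "IE_tuple_nat T k x"
  unfolding IE_tuple_nat_def
proof (intro allI impI)
  fix U :: "nat \<Rightarrow> 'a set" assume U: "\<forall>i<k. x i \<in> interior (U i)"
  define P where "P = x ` {..<k}"
  have "finite P" by (simp add: P_def)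
  obtain G where G: "\<forall>p\<in>P. open (G p) \<and> p \<in> G p"
      "\<forall>p\<in>P. \<forall>q\<in>P. p \<noteq> q \<longrightarrow> G p \<inter> G q = {}"
    using separate_finite_points[OF \<open>finite P\<close>] by (elim exE conjE)
  \<comment> \<open>Intersecting over all indices of \<open>p\<close> lets one neighbourhood serve
    every repetition of the point.\<close>
  define H where "H p = G p \<inter> (\<Inter>i\<in>{i. i < k \<and> x i = p}. interior (U i))" for p
  have "\<forall>p\<in>P. \<exists>V. closed V \<and> p \<in> interior V \<and> V \<subseteq> H p"
    using U G(1) by (intro ballI compact_t2_closed_neighbourhood[OF assms(1)])
      (auto simp: H_def intro!: open_Int open_INT)
  from bchoice[OF this] obtain V
    where V: "\<forall>p\<in>P. closed (V p) \<and> p \<in> interior (V p) \<and> V p \<subseteq> H p" by (rule exE)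
  have V_disj: "V p \<inter> V q = {}" if "p \<in> P" "q \<in> P" "p \<noteq> q" for p q
  proof -
    have "V p \<subseteq> G p" "V q \<subseteq> G q" using V that by (auto simp: H_def)
    moreover have "G p \<inter> G q = {}" using G(2) that by simp
    ultimately show ?thesis by blast
  qed
  have V_sub: "V (x i) \<subseteq> U i" if "i < k" for i
  proof -
    have "V (x i) \<subseteq> H (x i)" using V that by (simp add: P_def)
    also have "\<dots> \<subseteq> interior (U i)" using that by (auto simp: H_def)
    finally show ?thesis using interior_subset by blast
  qed
  have pos: "cover_entropy T {- V (x i) | i. i < k} > 0"
    using assms(2)[unfolded entropy_tuple_def, THEN conjunct2, rule_format, of "\<lambda>i. V (x i)"] V V_disj
    by (auto simp: P_def)
  \<comment> \<open>The shattering bound needs disjoint sets at distinct indices, so the distinct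
    points are enumerated anew.\<close>
  define l where "l = card P"
  obtain e where e: "bij_betw e {..<l} P"
    using ex_bij_betw_nat_finite[OF \<open>finite P\<close>] by (auto simp: l_def atLeast0LessThan)
  have "l \<ge> 2"
  proof -
    obtain i j where "i < k" "j < k" "x i \<noteq> x j"
      using assms(2) by (auto simp: entropy_tuple_def off_diagonal_def)
    then have "card {x i, x j} \<le> l" unfolding l_def P_def by (intro card_mono) auto
    then show ?thesis using \<open>x i \<noteq> x j\<close> by simp
  qed
  have "{- V (x i) | i. i < k} = (\<lambda>p. - V p) ` P" by (auto simp: P_def)
  also have "\<dots> = {- V (e j) | j. j < l}" using e by (auto simp: bij_betw_def)
  finally have "cover_entropy T {- V (e j) | j. j < l} > 0" using pos by simp
  moreover have "V (e i) \<inter> V (e j) = {}" if "i < l" "j < l" "i \<noteq> j" for i j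
    using that e by (intro V_disj) (auto simp: bij_betw_def inj_on_def)
  ultimately obtain c where c: "c > 0"
      "\<forall>N. \<exists>n\<ge>N. \<exists>W\<subseteq>{..<n}. indep_set_nat T l (\<lambda>j. V (e j)) W \<and> c * real n \<le> real (card W)"
    using indep_if_cover_entropy_pos[OF \<open>l \<ge> 2\<close>, of "\<lambda>j. V (e j)" T] by blast
  have "\<exists>J. (\<forall>W\<subseteq>J. finite W \<longrightarrow> indep_set_nat T l (\<lambda>j. V (e j)) W) \<and> pos_density_nat J"
    by (rule density_of_hereditary_family[OF indep_set_nat_mono indep_set_nat_shift c(1) c(2)[rule_format]])
  then obtain J where J: "\<forall>W\<subseteq>J. finite W \<longrightarrow> indep_set_nat T l (\<lambda>j. V (e j)) W" "pos_density_nat J"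
    by (elim exE conjE)
  have "indep_set_nat T k U J"
    unfolding indep_set_nat_def
  proof (intro allI impI)
    fix I and \<sigma> :: "nat \<Rightarrow> nat"
    assume I: "I \<subseteq> J \<and> finite I \<and> I \<noteq> {} \<and> (\<forall>s\<in>I. \<sigma> s < k)"
    define \<tau> where "\<tau> s = inv_into {..<l} e (x (\<sigma> s))" for s
    have \<tau>: "\<tau> s < l" "e (\<tau> s) = x (\<sigma> s)" if "s \<in> I" for s
    proof -
      have "x (\<sigma> s) \<in> e ` {..<l}" using I that e by (auto simp: P_def bij_betw_def)
      then show "\<tau> s < l" "e (\<tau> s) = x (\<sigma> s)"
        unfolding \<tau>_def using inv_into_into[of "x (\<sigma> s)" e "{..<l}"] by (auto simp: f_inv_into_f)
    qed
    have "indep_set_nat T l (\<lambda>j. V (e j)) I" using J(1) I by blast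
    then have "(\<Inter>s\<in>I. (T ^^ s) -` V (e (\<tau> s))) \<noteq> {}"
      using I \<tau>(1) unfolding indep_set_nat_def by blast
    moreover have "(\<Inter>s\<in>I. (T ^^ s) -` V (e (\<tau> s))) \<subseteq> (\<Inter>s\<in>I. (T ^^ s) -` U (\<sigma> s))"
      using V_sub I \<tau>(2) by fastforce
    ultimately show "(\<Inter>s\<in>I. (T ^^ s) -` U (\<sigma> s)) \<noteq> {}" by blast
  qed
  with J(2) show "\<exists>J. indep_set_nat T k U J \<and> pos_density_nat J" by blast
qed

text \<open>Common target of both converse implications: linear-size independence sets in windows, a
  condition that involves only forward times.\<close>

lemma entropy_tuple_if_indep:
  assumes "k \<ge> 2" "off_diagonal k x"
    and indep: "\<And>V. (\<forall>i<k. x i \<in> interior (V i)) \<Longrightarrow>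
      \<exists>c>0. \<forall>N. \<exists>n\<ge>N. \<exists>I\<subseteq>{..<n}. indep_set_nat T k V I \<and> c * real n \<le> real (card I)"
  shows "entropy_tuple T k x"
  unfolding entropy_tuple_def
proof (intro conjI allI impI)
  fix V :: "nat \<Rightarrow> 'a set"
  assume V: "(\<forall>i<k. closed (V i) \<and> x i \<in> interior (V i)) \<and>
    (\<forall>i<k. \<forall>j<k. (x i = x j \<longrightarrow> V i = V j) \<and> (x i \<noteq> x j \<longrightarrow> V i \<inter> V j = {}))"
  obtain i j where "i < k" "j < k" "x i \<noteq> x j"
    using assms(2) by (auto simp: off_diagonal_def)
  moreover from this have "V i \<inter> V j = {}"
    using V[THEN conjunct2, THEN spec, of i, THEN mp, THEN spec, of j, THEN mp, THEN conjunct2, THEN mp]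
    by simp
  ultimately have "\<Union>{- V i | i. i < k} = UNIV" by (intro Union_complements)
  moreover have "\<forall>i<k. x i \<in> interior (V i)" using V[THEN conjunct1] by simp
  from indep[OF this] obtain c where "c > 0"
    "\<And>N. \<exists>n\<ge>N. \<exists>I\<subseteq>{..<n}. indep_set_nat T k V I \<and> c * real n \<le> real (card I)"
    by auto
  ultimately show "cover_entropy T {- V i | i. i < k} > 0"
    using cover_entropy_pos_if_indep[OF \<open>k \<ge> 2\<close>] by blast
qed (rule assms)

text \<open>A nonzero limit of nonnegative quotients is positive, and half of it is eventually
  exceeded. Used with window lengths \<open>n + 1\<close> and \<open>2 * n + 1\<close>.\<close>

lemma frequently_ge_of_LIMSEQ_nonzero:
  fixes f :: "nat \<Rightarrow> nat" and g :: "nat \<Rightarrow> nat"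
  assumes lim: "(\<lambda>n. real (f n) / real (g n)) \<longlonglongrightarrow> d" and "d \<noteq> 0"
    and g: "\<And>n. g n > n"
  shows "\<exists>c>0. \<forall>N. \<exists>n\<ge>N. c * real (g n) \<le> real (f n)"
proof (intro exI[of _ "d / 2"] conjI allI)
  have "d \<ge> 0" by (rule LIMSEQ_le_const[OF lim]) auto
  then show "d / 2 > 0" using \<open>d \<noteq> 0\<close> by simp
  have "\<forall>\<^sub>F n in sequentially. d / 2 < real (f n) / real (g n)"
    using \<open>d \<ge> 0\<close> \<open>d \<noteq> 0\<close> by (intro order_tendstoD(1)[OF lim]) simp
  then obtain M where M: "\<And>n. n \<ge> M \<Longrightarrow> d / 2 < real (f n) / real (g n)"
    by (auto simp: eventually_sequentially)
  show "\<exists>n\<ge>N. d / 2 * real (g n) \<le> real (f n)" for N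
  proof (intro exI[of _ "max N M"] conjI)
    have "0 < g (max N M)" using g[of "max N M"] by linarith
    then show "d / 2 * real (g (max N M)) \<le> real (f (max N M))"
      using M[of "max N M"] by (simp add: field_simps)
  qed simp
qed

lemma IE_tuple_nat_imp_entropy_tuple:
  assumes "k \<ge> 2" "off_diagonal k x" "IE_tuple_nat T k x"
  shows "entropy_tuple T k x"
proof (rule entropy_tuple_if_indep[OF assms(1,2)])
  fix V assume "\<forall>i<k. x i \<in> interior (V i)"
  then obtain J d where J: "indep_set_nat T k V J" "d \<noteq> 0"
      "(\<lambda>n. real (card (J \<inter> {0..n})) / real (n + 1)) \<longlonglongrightarrow> d"
    using assms(3) unfolding IE_tuple_nat_def pos_density_nat_def by blast
  obtain c where c: "c > 0" "\<And>N. \<exists>n\<ge>N. c * real (n + 1) \<le> real (card (J \<inter> {0..n}))"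
    using frequently_ge_of_LIMSEQ_nonzero[OF J(3,2)] by auto
  have "\<exists>n\<ge>N. \<exists>I\<subseteq>{..<n}. indep_set_nat T k V I \<and> c * real n \<le> real (card I)" for N
  proof -
    obtain n where n: "n \<ge> N" "c * real (n + 1) \<le> real (card (J \<inter> {0..n}))" using c(2) by blast
    \<comment> \<open>\<open>{0..n}\<close> is a window of length \<open>n + 1\<close>.\<close>
    show ?thesis
      by (intro exI[of _ "n + 1"] exI[of _ "J \<inter> {0..n}"] conjI indep_set_nat_mono[OF J(1)] n(2))
        (use n(1) in auto)
  qed
  then show "\<exists>c>0. \<forall>N. \<exists>n\<ge>N. \<exists>I\<subseteq>{..<n}. indep_set_nat T k V I \<and> c * real n \<le> real (card I)"
    using c(1) by blast
qed

text \<open>On nonnegative times \<open>zact\<close> is the forward iterate, so only the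
  normalisation of the density changes.\<close>

lemma IE_tuple_nat_imp_int:
  assumes "IE_tuple_nat T k x"
  shows "IE_tuple_int T k x"
  unfolding IE_tuple_int_def
proof (intro allI impI)
  fix U :: "nat \<Rightarrow> 'a set" assume "\<forall>i<k. x i \<in> interior (U i)"
  then obtain J d where J: "indep_set_nat T k U J" "d \<noteq> 0"
      "(\<lambda>n. real (card (J \<inter> {0..n})) / real (n + 1)) \<longlonglongrightarrow> d"
    using assms unfolding IE_tuple_nat_def pos_density_nat_def by blast
  have "indep_set_int T k U (int ` J)"
    unfolding indep_set_int_def
  proof (intro allI impI)
    fix I and \<sigma> :: "int \<Rightarrow> nat"
    assume I: "I \<subseteq> int ` J \<and> finite I \<and> I \<noteq> {} \<and> (\<forall>s\<in>I. \<sigma> s < k)"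
    then obtain I' where I': "I' \<subseteq> J" "I = int ` I'" by (meson subset_image_iff)
    then have "finite I'" using I by (simp add: finite_image_iff)
    then have "(\<Inter>s\<in>I'. (T ^^ s) -` U (\<sigma> (int s))) \<noteq> {}"
      using J(1)[unfolded indep_set_nat_def, rule_format, of I' "\<lambda>s. \<sigma> (int s)"] I I' by auto
    then show "(\<Inter>s\<in>I. zact T s -` U (\<sigma> s)) \<noteq> {}"
      by (simp add: I'(2) zact_def)
  qed
  moreover have "pos_density_int (int ` J)"
    unfolding pos_density_int_def
  proof (intro exI conjI)
    show "d * (1 / 2) \<noteq> 0" using J(2) by simp
    have "int ` J \<inter> {- int n..int n} = int ` (J \<inter> {0..n})" for n by auto
    then have card: "card (int ` J \<inter> {- int n..int n}) = card (J \<inter> {0..n})" for n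
      by (simp add: card_image)
    have "(\<lambda>n. real (n + 1) / real (2 * n + 1)) \<longlonglongrightarrow> 1 / 2"
    proof -
      have "(\<lambda>n. 1 / 2 + (1 / 2) / real (2 * n + 1)) \<longlonglongrightarrow> 1 / 2 + 0"
        by (intro tendsto_add tendsto_const LIMSEQ_subseq_LIMSEQ[OF lim_const_over_n, unfolded comp_def])
          (auto simp: strict_mono_def)
      moreover have "1 / 2 + (1 / 2) / real (2 * n + 1) = real (n + 1) / real (2 * n + 1)" for n
        by (simp add: field_simps)
      ultimately show ?thesis by simp
    qed
    from tendsto_mult[OF J(3) this]
    show "(\<lambda>n. real (card (int ` J \<inter> {- int n..int n})) / real (2 * n + 1)) \<longlonglongrightarrow> d * (1 / 2)"
      unfolding card by (rule Lim_transform_eventually) (auto simp del: of_nat_add of_nat_mult)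
  qed
  ultimately show "\<exists>J. indep_set_int T k U J \<and> pos_density_int J" by blast
qed

text \<open>Pulling the base point back by \<open>n\<close> steps turns the signed times
  \<open>t - n\<close> into forward times \<open>t\<close>.\<close>

lemma zact_funpow:
  assumes "bij T"
  shows "zact T (int t - int n) ((T ^^ n) w) = (T ^^ t) w"
proof (cases "n \<le> t")
  case True
  then have "nat (int t - int n) = t - n" by simp
  moreover have "(T ^^ t) w = (T ^^ (t - n)) ((T ^^ n) w)"
    using True funpow_add[of "t - n" n T] by simp
  ultimately show ?thesis using True by (simp add: zact_def)
next
  case False
  have "(inv T ^^ m) ((T ^^ m) u) = u" for m u
    using assms by (induction m arbitrary: u) (simp_all add: funpow_swap1[of T] funpow_swap1[of "inv T"] bij_is_inj)
  moreover have "(T ^^ n) w = (T ^^ (n - t)) ((T ^^ t) w)"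
    using False funpow_add[of "n - t" t T] by simp
  moreover have "nat (- (int t - int n)) = n - t" by simp
  ultimately show ?thesis using False by (simp add: zact_def)
qed

lemma indep_set_int_shift:
  assumes "bij T" and "indep_set_int T k A J"
  shows "indep_set_nat T k A {t. int t - int n \<in> J}"
  unfolding indep_set_nat_def
proof (intro allI impI)
  fix I and \<sigma> :: "nat \<Rightarrow> nat"
  assume I: "I \<subseteq> {t. int t - int n \<in> J} \<and> finite I \<and> I \<noteq> {} \<and> (\<forall>s\<in>I. \<sigma> s < k)"
  have "(\<Inter>s\<in>(\<lambda>t. int t - int n) ` I. zact T s -` A (\<sigma> (nat (s + int n)))) \<noteq> {}"
    using assms(2)[unfolded indep_set_int_def, rule_format,
        of "(\<lambda>t. int t - int n) ` I" "\<lambda>s. \<sigma> (nat (s + int n))"] I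
    by fastforce
  then obtain y where y: "\<forall>t\<in>I. zact T (int t - int n) y \<in> A (\<sigma> t)" by auto
  obtain w where "y = (T ^^ n) w"
    using surj_fn[OF bij_is_surj[OF assms(1)], of n] by (metis surjD)
  then have "w \<in> (\<Inter>t\<in>I. (T ^^ t) -` A (\<sigma> t))" using y by (simp add: zact_funpow[OF assms(1)])
  then show "(\<Inter>t\<in>I. (T ^^ t) -` A (\<sigma> t)) \<noteq> {}" by blast
qed

lemma IE_tuple_int_imp_entropy_tuple:
  assumes "bij T" "k \<ge> 2" "off_diagonal k x" "IE_tuple_int T k x"
  shows "entropy_tuple T k x"
proof (rule entropy_tuple_if_indep[OF assms(2,3)])
  fix V assume "\<forall>i<k. x i \<in> interior (V i)"
  then obtain J d where J: "indep_set_int T k V J" "d \<noteq> 0"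
      "(\<lambda>n. real (card (J \<inter> {- int n..int n})) / real (2 * n + 1)) \<longlonglongrightarrow> d"
    using assms(4) unfolding IE_tuple_int_def pos_density_int_def by blast
  obtain c where c: "c > 0" "\<And>N. \<exists>n\<ge>N. c * real (2 * n + 1) \<le> real (card (J \<inter> {- int n..int n}))"
    using frequently_ge_of_LIMSEQ_nonzero[OF J(3,2)] by auto
  have "\<exists>n\<ge>N. \<exists>I\<subseteq>{..<n}. indep_set_nat T k V I \<and> c * real n \<le> real (card I)" for N
  proof -
    obtain n where n: "n \<ge> N" "c * real (2 * n + 1) \<le> real (card (J \<inter> {- int n..int n}))"
      using c(2) by blast
    \<comment> \<open>Translation by \<open>n\<close> carries \<open>{- int n..int n}\<close> onto a
      forward window of length \<open>2 * n + 1\<close>.\<close>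
    define I where "I = {t. int t - int n \<in> J} \<inter> {..<2 * n + 1}"
    have "bij_betw (\<lambda>t. int t - int n) I (J \<inter> {- int n..int n})"
      by (rule bij_betw_byWitness[where f' = "\<lambda>s. nat (s + int n)"]) (auto simp: I_def)
    then have "card I = card (J \<inter> {- int n..int n})" by (rule bij_betw_same_card)
    moreover have "indep_set_nat T k V I"
      by (rule indep_set_nat_mono[OF indep_set_int_shift[OF assms(1) J(1), of n]]) (auto simp: I_def)
    ultimately show ?thesis using n
      by (intro exI[of _ "2 * n + 1"] exI[of _ I] conjI) (auto simp: I_def)
  qed
  then show "\<exists>c>0. \<forall>N. \<exists>n\<ge>N. \<exists>I\<subseteq>{..<n}. indep_set_nat T k V I \<and> c * real n \<le> real (card I)"
    using c(1) by blast
qed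

theorem theorem3p16:
  fixes T :: "'a::t2_space \<Rightarrow> 'a" and k :: nat and x :: "nat \<Rightarrow> 'a"
  assumes "compact (UNIV :: 'a set)"
    and "continuous_on UNIV T"
    and "surj T"
    and "k \<ge> 2"
    and "off_diagonal k x"
  shows "(entropy_tuple T k x \<longleftrightarrow> IE_tuple_nat T k x) \<and>
         (homeomorphism UNIV UNIV T (inv T) \<longrightarrow> (entropy_tuple T k x \<longleftrightarrow> IE_tuple_int T k x))"
proof (intro conjI impI)
  show nat: "entropy_tuple T k x \<longleftrightarrow> IE_tuple_nat T k x"
    using entropy_tuple_imp_IE_tuple_nat[OF assms(1)] IE_tuple_nat_imp_entropy_tuple[OF assms(4,5)]
    by blast
  assume "homeomorphism UNIV UNIV T (inv T)"
  then have "inj T" by (intro inj_on_inverseI[of _ "inv T"]) (simp add: homeomorphism_def)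
  then have "bij T" using assms(3) by (simp add: bij_def)
  \<comment> \<open>The circle closes: entropy tuple, one-sided IE-tuple, two-sided IE-tuple,
    entropy tuple.\<close>
  then show "entropy_tuple T k x \<longleftrightarrow> IE_tuple_int T k x"
    using nat IE_tuple_nat_imp_int IE_tuple_int_imp_entropy_tuple[OF _ assms(4,5)] by blast
qed

end
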